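(* Let the design $\xi^*$ be defined on $\mathcal X$ such that $\boldsymbol 0\in\mathrm{supp}(\xi^* )$. Let the design $\xi^*_{-\boldsymbol 0}$ on $\widetilde{\mathcal X}$ be the conditional measure of $\xi^*$ given $\boldsymbol x\ne\boldsymbol 0$, where $\widetilde{\mathcal X}\subseteq\mathcal X$. Let a parameter point $\boldsymbol\beta=(\beta_0,\tilde{\boldsymbol\beta}^{\mathsf T})^{\mathsf T}$ be given such that $\boldsymbol f_{\boldsymbol\beta}(\boldsymbol x)=\boldsymbol f_{\tilde{\boldsymbol\beta}}(\boldsymbol x)$ for all $\boldsymbol x\in\widetilde{\mathcal X}$, with $\boldsymbol f_{\tilde{\boldsymbol\beta}}(\boldsymbol 0)=\boldsymbol 0$. Assume there exists a constant vector $\boldsymbol c$ such that $\boldsymbol c^{\mathsf T}\boldsymbol f_{\tilde{\boldsymbol\beta}}(\boldsymbol x)=1$ for all $\boldsymbol x\in\mathrm{supp}(\xi^* )\setminus\{\boldsymbol 0\}$. Let $$\xi^*=\frac1{\nu+1}\,\xi_{\boldsymbol 0}+\frac{\nu}{\nu+1}\,\xi^*_{-\boldsymbol 0}.$$ Then: (1) If $\xi^*$ is locally D-optimal (at $\boldsymbol\beta$) for the model with intercept, then $\xi^*_{-\boldsymbol 0}$ is locally D-optimal (at $\tilde{\boldsymbol\beta}$) for the corresponding model without intercept. (2) If $\xi^*_{-\boldsymbol 0}$ is locally D-optimal (at $\tilde{\boldsymbol\beta}$) for the model without intercept and $$\boldsymbol f_{\tilde{\boldsymbol\beta}}^{\mathsf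 T}(\boldsymbol x)\,\widetilde{\boldsymbol M}^{-1}(\xi^*_{-\boldsymbol 0},\tilde{\boldsymbol\beta})\,\boldsymbol f_{\tilde{\boldsymbol\beta}}(\boldsymbol x)\le\nu\Bigl(1-\bigl(\boldsymbol c^{\mathsf T}\boldsymbol f_{\tilde{\boldsymbol\beta}}(\boldsymbol x)-1\bigr)^2\Bigr)\quad\text{for all }\boldsymbol x\in\mathcal X,$$ then $\xi^*$ is locally D-optimal (at $\boldsymbol\beta$) for the corresponding model with intercept.
   Context: Let $\nu\ge1$ and let $\mathcal X,\widetilde{\mathcal X}\subseteq\mathbb R^\nu$ be experimental regions. Nonlinear models $Y(\boldsymbol x)=h(\boldsymbol x,\cdot)+\varepsilon$ with error term $\varepsilon$ are considered. - Model with intercept on $\mathcal X$: parameter $\boldsymbol\beta=(\beta_0,\tilde{\boldsymbol\beta}^{\mathsf T})^{\mathsf T}$, $\tilde{\boldsymbol\beta}=(\beta_1,\dots,\beta_\nu)^{\mathsf T}$; the gradient of the mean function with respect to $\boldsymbol\beta$ is $(1,\boldsymbol f_{\boldsymbol\beta}^{\mathsf T}(\boldsymbol x))^{\mathsf T}$ with $\boldsymbol f_{\boldsymbol\beta}(\boldsymbol x)\in\mathbb R^\nu$ (the partial derivatives with respect to $\tilde{\boldsymbol\beta}$). - Corresponding model without intercept on $\widetilde{\mathcal X}$: parameter $\tilde{\boldsymbol\beta}$; the gradient of the mean function with respect to $\tilde{\boldsymbol\beta}$ is $\boldsymbol f_{\tilde{\boldsymbol\beta}}(\boldsymbol x)\in\mathbb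 R^\nu$ (this expression is also evaluated at $\boldsymbol x\in\mathcal X$). A design $\xi$ on a region is a probability measure with finite support $\mathrm{supp}(\xi)$ in that region and positive weights at the support points; $\xi_{\boldsymbol 0}$ is the one-point design at the origin $\boldsymbol 0$. The information matrices are $$\widetilde{\boldsymbol M}(\xi,\tilde{\boldsymbol\beta})=\int_{\widetilde{\mathcal X}}\boldsymbol f_{\tilde{\boldsymbol\beta}}(\boldsymbol x)\boldsymbol f_{\tilde{\boldsymbol\beta}}^{\mathsf T}(\boldsymbol x)\,\xi(\mathrm d\boldsymbol x)$$ for designs on $\widetilde{\mathcal X}$ under the model without intercept, and $$\boldsymbol M(\xi,\boldsymbol\beta)=\int_{\mathcal X}(1,\boldsymbol f_{\boldsymbol\beta}^{\mathsf T}(\boldsymbol x))^{\mathsf T}(1,\boldsymbol f_{\boldsymbol\beta}^{\mathsf T}(\boldsymbol x))\,\xi(\mathrm d\boldsymbol x)$$ for designs on $\mathcal X$ under the model with intercept. For a given model and parameter point, a design is locally D-optimal if it minimizes the determinant of the inverse information matrix over all designs on the model's experimental region whose information matrix (at that parameter point) is nonsingular.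
   Formalization: The gradients of the two models are assumed to agree on all of X, not only on the smaller region of the model without intercept; if the no-intercept expression were unrelated to the intercept gradient elsewhere (at 0 or in the inequality), both parts would fail. *)

theory Defs
  imports "HOL-Probability.Probability"
begin

text \<open>A design is a probability mass function with finite support; the support points are exactly
  the points of positive weight. The dimension is \<open>\<nu> = CARD('n)\<close>.\<close>

definition design_on :: "'a set \<Rightarrow> 'a pmf \<Rightarrow> bool" where
  "design_on X \<xi> \<longleftrightarrow> finite (set_pmf \<xi>) \<and> set_pmf \<xi> \<subseteq> X"

text \<open>The column vector \<open>(a, v\<^sup>T)\<^sup>T\<close> of length \<open>\<nu> + 1\<close>. The index type is
  \<open>'n option\<close>, and \<open>None\<close> is the position of the intercept.\<close>

definition with_intercept :: "real \<Rightarrow> real ^ 'n \<Rightarrow> real ^ ('n::finite option)" where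
  "with_intercept a v = (\<chi> i. case i of None \<Rightarrow> a | Some j \<Rightarrow> v $ j)"

definition outer_product :: "real ^ 'm \<Rightarrow> real ^ 'm \<Rightarrow> real ^ 'm ^ 'm" where
  "outer_product u v = (\<chi> i j. u $ i * v $ j)"

text \<open>Here \<open>g \<theta> x\<close> stands for the gradient of the mean function at \<open>x\<close> with respect to the
  parameter, taken at the parameter point \<open>\<theta>\<close>.\<close>

definition information_matrix ::
  "('p \<Rightarrow> 'a \<Rightarrow> real ^ 'm) \<Rightarrow> 'a pmf \<Rightarrow> 'p \<Rightarrow> real ^ 'm ^ ('m::finite)" where
  "information_matrix g \<xi> \<theta> = (\<integral>x. outer_product (g \<theta> x) (g \<theta> x) \<partial>measure_pmf \<xi>)"

definition locally_D_optimal ::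
  "'a set \<Rightarrow> ('p \<Rightarrow> 'a \<Rightarrow> real ^ ('m::finite)) \<Rightarrow> 'p \<Rightarrow> 'a pmf \<Rightarrow> bool" where
  "locally_D_optimal X g \<theta> \<xi> \<longleftrightarrow>
     design_on X \<xi> \<and> invertible (information_matrix g \<xi> \<theta>) \<and>
     (\<forall>\<eta>. design_on X \<eta> \<and> invertible (information_matrix g \<eta> \<theta>) \<longrightarrow>
        det (matrix_inv (information_matrix g \<xi> \<theta>))
          \<le> det (matrix_inv (information_matrix g \<eta> \<theta>)))"

end

theory Submission imports Defs begin

text \<open>Subtracting \<open>c\<close> times the lower rows from the intercept row turns the regressor
  \<open>(1, g(x))\<close> into \<open>(1 - c \<bullet> g(x), g(x))\<close> without changing determinants. If \<open>c\<close> makes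
  \<open>1 - c \<bullet> g\<close> orthogonal to \<open>g\<close> under \<open>\<eta>\<close>, the information matrix of \<open>p \<xi>\<^sub>0 + (1 - p) \<eta>\<close>
  becomes block diagonal, so its determinant is at least \<open>p (1 - p)\<^sup>\<nu>\<close> times that of the reduced
  model, with equality when \<open>c \<bullet> g = 1\<close> on the support of \<open>\<eta>\<close>. Comparing such mixtures gives
  part (1) directly, without an equivalence theorem. For part (2), the hypothesis says that the
  sensitivity function in the intercept model is at most \<open>\<nu> + 1\<close>, and the sufficient half of the
  Kiefer--Wolfowitz theorem applies: after diagonalizing the two information matrices
  simultaneously, it is the inequality of arithmetic and geometric means.\<close>

section \<open>Determinants of block triangular matrices\<close>

text \<open>In the Leibniz expansion a permutation that moves \<open>None\<close> picks a zero from
  row \<open>None\<close>. The remaining ones are transported along \<open>Some\<close> from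
  permutations of \<open>'n\<close>, with the same sign.\<close>

lemma det_block_option:
  fixes A :: "'a::comm_ring_1 ^ ('n::finite option) ^ ('n option)"
  assumes "\<And>j. A $ None $ Some j = 0"
  shows "det A = A $ None $ None * det (\<chi> i j. A $ Some i $ Some j)"
proof -
  let ?g = "\<lambda>p. of_int (sign p) * (\<Prod>i\<in>UNIV. A $ i $ p i)"
  let ?F = "map_permutation UNIV (Some :: 'n \<Rightarrow> _)"
  let ?P = "{p. p permutes range (Some :: 'n \<Rightarrow> _)}"
  have bij_Some: "bij_betw (Some :: 'n \<Rightarrow> _) UNIV (range Some)"
    by (simp add: bij_betw_def)
  have UNIV_eq: "(UNIV :: 'n option set) = insert None (range Some)"
    by (rule UNIV_option_conv)
  have off: "?g p = 0" if "p permutes UNIV" "p \<notin> ?P" for p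
  proof -
    have "p None \<noteq> None"
    proof
      assume "p None = None"
      then have "p permutes range (Some :: 'n \<Rightarrow> _)"
        using that(1) permutes_superset[of p UNIV "range Some"]
        by (metis DiffD2 notin_range_Some)
      with that show False by simp
    qed
    then obtain j where "p None = Some j" by auto
    then have "A $ None $ p None = 0" using assms by simp
    then have "(\<Prod>i\<in>UNIV. A $ i $ p i) = 0"
      by (intro prod_zero) auto
    then show ?thesis by simp
  qed
  have bij: "bij_betw ?F {p. p permutes UNIV} ?P"
  proof (rule bij_betw_byWitness[where f' = "map_permutation (range Some) the"])
    show "\<forall>p\<in>{p. p permutes (UNIV :: 'n set)}. map_permutation (range Some) the (?F p) = p"
      using map_permutation_compose_inv[OF bij_Some] by auto
    have the: "bij_betw the (range Some) (UNIV :: 'n set)"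
      by (rule bij_betwI[where g = Some]) auto
    show "\<forall>p\<in>?P. ?F (map_permutation (range Some) the p) = p"
    proof
      fix p assume "p \<in> ?P"
      then show "?F (map_permutation (range Some) the p) = p"
        by (intro map_permutation_compose_inv[OF the]) auto
    qed
    show "map_permutation (range Some) the ` ?P \<subseteq> {p. p permutes (UNIV :: 'n set)}"
      using map_permutation_permutes[OF the] by blast
    show "?F ` {p. p permutes UNIV} \<subseteq> ?P"
      using map_permutation_permutes[OF bij_Some] by auto
  qed
  have summand: "?g (?F p) = A $ None $ None *
      (of_int (sign p) * (\<Prod>i\<in>UNIV. A $ Some i $ Some (p i)))" if "p permutes UNIV" for p
  proof -
    have "sign (?F p) = sign p"
      using that by (intro sign_map_permutation) auto
    \<comment> \<open>\<open>map_permutation\<close> is the identity outside the transported set,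
      and \<open>None\<close> lies outside \<open>range Some\<close>.\<close>
    moreover have "?F p None = None"
      by (simp add: map_permutation_def)
    moreover have "?F p (Some i) = Some (p i)" for i
      by (simp add: map_permutation_apply)
    ultimately show ?thesis
      by (simp add: UNIV_eq prod.reindex mult_ac)
  qed
  have "det A = (\<Sum>p\<in>{p. p permutes UNIV}. ?g p)"
    by (simp add: det_def)
  also have "\<dots> = (\<Sum>p\<in>?P. ?g p)"
    using off by (intro sum.mono_neutral_right) (auto intro: permutes_subset)
  also have "\<dots> = (\<Sum>p\<in>{p. p permutes UNIV}. ?g (?F p))"
    by (rule sum.reindex_bij_betw[OF bij, symmetric])
  also have "\<dots> = (\<Sum>p\<in>{p. p permutes UNIV}. A $ None $ None *
      (of_int (sign p) * (\<Prod>i\<in>UNIV. A $ Some i $ Some (p i))))"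
    using summand by (intro sum.cong) auto
  also have "\<dots> = A $ None $ None * det (\<chi> i j. A $ Some i $ Some j)"
    by (simp add: det_def sum_distrib_left)
  finally show ?thesis .
qed

section \<open>Simultaneous diagonalization of two symmetric matrices\<close>

lemma inner_symmetric_matrix:
  fixes A :: "real ^ 'm ^ 'm"
  assumes "transpose A = A"
  shows "x \<bullet> (A *v y) = y \<bullet> (A *v x)"
  by (metis assms dot_lmul_matrix inner_commute transpose_matrix_vector)

text \<open>This is the spectral theorem for the form \<open>N\<close> in the inner product given by
  \<open>A\<close>. General subspaces \<open>S\<close> let the induction pass to the
  \<open>A\<close>-orthogonal complement of the first basis vector.\<close>

lemma simultaneously_orthogonal_basis:
  fixes A N :: "real ^ 'm ^ 'm"
  assumes symA: "transpose A = A" and symN: "transpose N = N"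
    and pd: "\<And>x. x \<noteq> 0 \<Longrightarrow> 0 < x \<bullet> (A *v x)"
  shows "subspace S \<Longrightarrow> \<exists>B. B \<subseteq> S \<and> finite B \<and> card B = dim S \<and> (\<forall>b\<in>B. b \<bullet> (A *v b) = 1) \<and>
    (\<forall>b\<in>B. \<forall>b'\<in>B. b \<noteq> b' \<longrightarrow> b \<bullet> (A *v b') = 0 \<and> b \<bullet> (N *v b') = 0)"
proof (induction "dim S" arbitrary: S)
  case 0
  then show ?case by (intro exI[of _ "{}"]) auto
next
  case (Suc k)
  txt \<open>A maximizer of the Rayleigh quotient is the first basis vector; stationarity makes its
    \<open>A\<close>-orthogonal complement also \<open>N\<close>-orthogonal to it.\<close>
  let ?K = "S \<inter> sphere 0 1"
  let ?r = "\<lambda>x. (x \<bullet> (N *v x)) / (x \<bullet> (A *v x))"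
  obtain w where w: "w \<in> S" "w \<noteq> 0"
    using Suc.hyps(2) by (metis dim_eq_0 empty_subsetI insert_iff nat.distinct(1) subsetI)
  have "(1 / norm w) *\<^sub>R w \<in> ?K"
    using w Suc.prems by (auto simp: subspace_scale)
  then have "?K \<noteq> {}" by blast
  moreover have "compact ?K"
    using closed_subspace[OF Suc.prems] by (intro closed_Int_compact) auto
  moreover have "continuous_on ?K ?r"
  proof (intro continuous_intros ballI)
    fix x assume "x \<in> ?K"
    then have "x \<noteq> 0" by auto
    then show "x \<bullet> (A *v x) \<noteq> 0" using pd[of x] by simp
  qed
  ultimately obtain x0 where x0: "x0 \<in> ?K" and max: "\<And>x. x \<in> ?K \<Longrightarrow> ?r x \<le> ?r x0"
    using continuous_attains_sup[of ?K ?r] by blast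
  have "x0 \<noteq> 0" using x0 by auto
  then have A0: "0 < x0 \<bullet> (A *v x0)" by (rule pd)
  define l where "l = ?r x0"
  define u where "u = (1 / sqrt (x0 \<bullet> (A *v x0))) *\<^sub>R x0"
  have uS: "u \<in> S" using x0 Suc.prems by (auto simp: u_def subspace_scale)
  have uA: "u \<bullet> (A *v u) = 1"
    using A0 by (simp add: u_def matrix_vector_mult_scaleR)
  have uN: "u \<bullet> (N *v u) = l"
    using A0 by (simp add: u_def l_def matrix_vector_mult_scaleR)
  \<comment> \<open>The quotient is invariant under scaling, so its maximum over the unit sphere
    bounds it on all of \<open>S\<close>.\<close>
  have bound: "x \<bullet> (N *v x) \<le> l * (x \<bullet> (A *v x))" if "x \<in> S" for x
  proof (cases "x = 0")
    case False
    have "(1 / norm x) *\<^sub>R x \<in> ?K"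
      using False that Suc.prems by (auto simp: subspace_scale)
    from max[OF this] have "?r x \<le> l"
      using False by (simp add: l_def matrix_vector_mult_scaleR)
    then show ?thesis using pd[OF False] by (simp add: divide_le_eq)
  qed simp
  define S' where "S' = {v \<in> S. u \<bullet> (A *v v) = 0}"
  have sub': "subspace S'"
    using Suc.prems unfolding S'_def
    by (auto simp: subspace_def matrix_vector_right_distrib matrix_vector_mult_scaleR
        inner_add_right)
  have notin: "u \<notin> span S'"
  proof -
    have "span S' = S'" using sub' by (simp add: span_eq_iff)
    moreover have "u \<notin> S'" using uA by (simp add: S'_def)
    ultimately show ?thesis by metis
  qed
  \<comment> \<open>One Gram-Schmidt step in the inner product of \<open>A\<close> splits off
    \<open>u\<close>, so the dimension drops by exactly one.\<close>
  have "S \<subseteq> span (insert u S')"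
  proof
    fix x assume x: "x \<in> S"
    have "x - (u \<bullet> (A *v x)) *\<^sub>R u \<in> S'"
      using x uS uA Suc.prems
      by (auto simp: S'_def subspace_diff subspace_scale matrix_vector_mult_diff_distrib
          matrix_vector_mult_scaleR inner_diff_right)
    then have "x - (u \<bullet> (A *v x)) *\<^sub>R u \<in> span S'" by (rule span_base)
    then show "x \<in> span (insert u S')" by (auto simp: span_insert)
  qed
  moreover have "insert u S' \<subseteq> S" using uS by (auto simp: S'_def)
  ultimately have "dim S = dim (insert u S')"
    by (metis dim_span dim_subset dual_order.antisym)
  then have dimS: "dim S = Suc (dim S')"
    using notin by (simp add: dim_insert)
  then obtain B where B: "B \<subseteq> S'" "finite B" "card B = dim S'" "\<forall>b\<in>B. b \<bullet> (A *v b) = 1"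
    "\<forall>b\<in>B. \<forall>b'\<in>B. b \<noteq> b' \<longrightarrow> b \<bullet> (A *v b') = 0 \<and> b \<bullet> (N *v b') = 0"
    using Suc.hyps(1)[OF _ sub'] Suc.hyps(2) by auto
  have orthN: "u \<bullet> (N *v v) = 0" if v: "v \<in> S'" for v
  proof (rule ccontr)
    assume nz: "u \<bullet> (N *v v) \<noteq> 0"
    define a where "a = u \<bullet> (N *v v)"
    \<comment> \<open>The summand 1 keeps \<open>K\<close> positive, so that
      \<open>t = a / K\<close> can be inserted below; there the linear term in \<open>t\<close>
      outweighs the quadratic one unless \<open>a = 0\<close>.\<close>
    define K where "K = \<bar>l * (v \<bullet> (A *v v)) - v \<bullet> (N *v v)\<bar> + 1"
    have uv: "u \<bullet> (A *v v) = 0" and vS: "v \<in> S" using v by (auto simp: S'_def)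
    have le: "2 * t * a \<le> t\<^sup>2 * K" for t
    proof -
      have "u + t *\<^sub>R v \<in> S" using uS vS Suc.prems by (simp add: subspace_add subspace_scale)
      from bound[OF this]
      have "2 * t * a \<le> t\<^sup>2 * (l * (v \<bullet> (A *v v)) - v \<bullet> (N *v v))"
        using uv uA uN inner_symmetric_matrix[OF symA, of v u]
          inner_symmetric_matrix[OF symN, of v u]
        by (simp add: a_def matrix_vector_right_distrib matrix_vector_mult_scaleR
          inner_add_left inner_add_right algebra_simps power2_eq_square)
      also have "\<dots> \<le> t\<^sup>2 * K" by (intro mult_left_mono) (auto simp: K_def)
      finally show ?thesis .
    qed
    have K: "K > 0" by (simp add: K_def)
    have "2 * (a\<^sup>2 / K) \<le> a\<^sup>2 / K"
      using le[of "a / K"] K by (simp add: power2_eq_square field_simps)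
    then have "a\<^sup>2 / K \<le> 0" by simp
    then show False using K nz by (simp add: a_def divide_le_0_iff)
  qed
  have uB: "u \<notin> B" using B(1) uA by (auto simp: S'_def)
  show ?case
  proof (intro exI[of _ "insert u B"] conjI ballI impI)
    show "insert u B \<subseteq> S" using B(1) uS by (auto simp: S'_def)
    show "card (insert u B) = dim S" using uB B dimS by simp
    fix b b' assume b: "b \<in> insert u B" "b' \<in> insert u B" "b \<noteq> b'"
    show "b \<bullet> (A *v b') = 0" "b \<bullet> (N *v b') = 0"
      using b B(1,5) orthN inner_symmetric_matrix[OF symA, of b b']
        inner_symmetric_matrix[OF symN, of b b'] by (auto simp: S'_def)
  qed (use B uA in auto)
qed

lemma congruence_entry:
  fixes P A :: "real ^ 'm ^ 'm"
  shows "(P ** A ** transpose P) $ i $ j = row i P \<bullet> (A *v row j P)"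
proof -
  have "(P ** A ** transpose P) $ i $ j = axis i 1 \<bullet> ((P ** A ** transpose P) *v axis j 1)"
    by (simp add: matrix_vector_mul_component inner_axis inner_axis')
  also have "\<dots> = (transpose P *v axis i 1) \<bullet> (A *v (transpose P *v axis j 1))"
    by (metis dot_lmul_matrix matrix_vector_mul_assoc transpose_matrix_vector)
  finally show ?thesis by (simp only: matrix_vector_mult_basis column_transpose)
qed

lemma simultaneous_diagonalization:
  fixes A N :: "real ^ 'm ^ 'm"
  assumes "transpose A = A" "transpose N = N" "\<And>x. x \<noteq> 0 \<Longrightarrow> 0 < x \<bullet> (A *v x)"
  obtains P :: "real ^ 'm ^ 'm" where "P ** A ** transpose P = mat 1"
    "\<And>i j. i \<noteq> j \<Longrightarrow> (P ** N ** transpose P) $ i $ j = 0"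
proof -
  obtain B :: "(real ^ 'm) set" where B: "finite B" "card B = CARD('m)"
    "\<forall>b\<in>B. b \<bullet> (A *v b) = 1"
    "\<forall>b\<in>B. \<forall>b'\<in>B. b \<noteq> b' \<longrightarrow> b \<bullet> (A *v b') = 0 \<and> b \<bullet> (N *v b') = 0"
    using simultaneously_orthogonal_basis[OF assms subspace_UNIV] by (auto simp: dim_UNIV)
  obtain e :: "'m \<Rightarrow> real ^ 'm" where e: "bij_betw e UNIV B"
    using finite_same_card_bij[of "UNIV :: 'm set" B] B by auto
  have eB: "e i \<in> B" and e_neq: "i \<noteq> j \<Longrightarrow> e i \<noteq> e j" for i j
    using e by (auto simp: bij_betw_def inj_eq)
  define P :: "real ^ 'm ^ 'm" where "P = (\<chi> i. e i)"
  have row: "row i P = e i" for i by (simp add: P_def row_def vec_eq_iff)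
  show thesis
  proof
    show "P ** A ** transpose P = mat 1"
      using B eB e_neq by (simp add: vec_eq_iff congruence_entry row mat_def)
    show "(P ** N ** transpose P) $ i $ j = 0" if "i \<noteq> j" for i j
      using B eB e_neq that by (simp add: congruence_entry row)
  qed
qed

section \<open>Inverses, determinants and the arithmetic-geometric mean inequality\<close>

lemma matrix_inv_mult:
  fixes A :: "'a::semiring_1 ^ 'n ^ 'm"
  assumes "invertible A"
  shows "A ** matrix_inv A = mat 1" "matrix_inv A ** A = mat 1"
  using someI_ex[OF assms[unfolded invertible_def]] by (simp_all add: matrix_inv_def)

lemma matrix_inv_mult_vec_eqI:
  fixes A :: "real ^ 'm ^ 'm"
  assumes "invertible A" "A *v y = x"
  shows "matrix_inv A *v x = y"
  using matrix_inv_mult(2)[OF assms(1)] assms(2) by (metis matrix_vector_mul_assoc matrix_vector_mul_lid)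

lemma det_matrix_inv:
  fixes A :: "'a::field ^ 'm ^ 'm"
  assumes "invertible A"
  shows "det (matrix_inv A) = 1 / det A"
proof -
  have "det A * det (matrix_inv A) = 1"
    by (metis assms det_I det_mul matrix_inv_mult(1))
  then show ?thesis using assms by (simp add: invertible_det_nz field_simps)
qed

lemma det_scaleR:
  fixes A :: "real ^ 'm ^ 'm"
  shows "det (r *\<^sub>R A) = r ^ CARD('m) * det A"
proof -
  have "r *\<^sub>R A = (\<chi> i. r *s (A $ i))"
    by (simp add: vec_eq_iff)
  then show ?thesis using det_rows_mul[of "\<lambda>_. r" "\<lambda>i. A $ i"] by simp
qed

text \<open>If the product exceeded 1, so would the geometric mean, whereas the arithmetic mean is
  at most 1.\<close>

lemma prod_le_1_if_sum_le_card:
  fixes d :: "'a \<Rightarrow> real"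
  assumes "finite S" "S \<noteq> {}" "\<And>i. i \<in> S \<Longrightarrow> 0 \<le> d i" "sum d S \<le> card S"
  shows "prod d S \<le> 1"
proof (rule ccontr)
  assume "\<not> prod d S \<le> 1"
  then have "1 < prod d S powr (1 / card S)"
    using assms by (intro gr_one_powr) (auto simp: card_gt_0_iff)
  also have "\<dots> \<le> (\<Sum>i\<in>S. d i / card S)"
    using assms by (intro arith_geom_mean) auto
  also have "\<dots> \<le> 1"
    using assms by (simp add: card_gt_0_iff divide_le_eq flip: sum_divide_distrib)
  finally show False by simp
qed

text \<open>Both congruences multiply the determinant by the same factor, the square of
  \<open>det P\<close>, which the first one shows to be the reciprocal of
  \<open>det A\<close>.\<close>

lemma det_eq_prod_diagonalized:
  fixes A N P :: "real ^ 'm ^ 'm"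
  assumes "P ** A ** transpose P = mat 1"
    and "\<And>i j. i \<noteq> j \<Longrightarrow> (P ** N ** transpose P) $ i $ j = 0"
  shows "det N = det A * (\<Prod>i\<in>UNIV. row i P \<bullet> (N *v row i P))"
proof -
  have "det P * det A * det P = 1"
    by (metis assms(1) det_I det_mul det_transpose)
  moreover have "det P * det N * det P = (\<Prod>i\<in>UNIV. row i P \<bullet> (N *v row i P))"
    using det_diagonal[OF assms(2)] by (simp add: det_mul congruence_entry)
  ultimately show ?thesis by algebra
qed

text \<open>A right inverse of the square matrix \<open>P\<close> is also a left inverse, so
  \<open>P\<close> can be moved to the other end of the product.\<close>

lemma transpose_mult_self_eq_matrix_inv:
  fixes A P :: "real ^ 'm ^ 'm"
  assumes "P ** A ** transpose P = mat 1"
  shows "transpose P ** P = matrix_inv A"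
proof -
  have "(A ** transpose P) ** P = mat 1"
    using assms by (simp add: matrix_mul_assoc[symmetric] matrix_left_right_inverse[of P])
  then have *: "A ** (transpose P ** P) = mat 1" by (simp add: matrix_mul_assoc)
  then have inv: "invertible A"
    by (metis invertible_def matrix_left_right_inverse)
  show "transpose P ** P = matrix_inv A"
    by (metis * inv matrix_inv_mult(2) matrix_mul_assoc matrix_mul_lid matrix_mul_rid)
qed

section \<open>Information matrices as finite weighted sums of outer products\<close>

lemma information_matrix_sum:
  assumes "finite (set_pmf \<xi>)"
  shows "information_matrix g \<xi> \<theta> =
    (\<Sum>x\<in>set_pmf \<xi>. pmf \<xi> x *\<^sub>R outer_product (g \<theta> x) (g \<theta> x))"
  unfolding information_matrix_def using assms by (intro integral_measure_pmf) auto

text \<open>A design sees the gradients only on its support. The two parameter points may have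
  different types, as they do for the models with and without intercept.\<close>

lemma information_matrix_cong:
  assumes "finite (set_pmf \<xi>)" "\<And>x. x \<in> set_pmf \<xi> \<Longrightarrow> g \<theta> x = g' \<theta>' x"
  shows "information_matrix g \<xi> \<theta> = information_matrix g' \<xi> \<theta>'"
  using assms by (simp add: information_matrix_sum)

lemma transpose_information_matrix:
  assumes "finite (set_pmf \<xi>)"
  shows "transpose (information_matrix g \<xi> \<theta>) = information_matrix g \<xi> \<theta>"
  using assms by (simp add: information_matrix_sum transpose_def vec_eq_iff outer_product_def mult_ac)

lemma outer_product_mult_vec: "outer_product u v *v w = (v \<bullet> w) *\<^sub>R u"
  by (simp add: vec_eq_iff outer_product_def matrix_vector_mult_def inner_vec_def
      sum_distrib_left sum_distrib_right mult_ac)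

lemma sum_matrix_vector_mult:
  fixes B :: "'a \<Rightarrow> 'b::semiring_1 ^ 'm ^ 'n"
  shows "(\<Sum>x\<in>S. B x) *v y = (\<Sum>x\<in>S. B x *v y)"
  by (induction S rule: infinite_finite_induct) (auto simp: matrix_vector_mult_add_rdistrib)

lemma information_matrix_mult_vec:
  assumes "finite (set_pmf \<xi>)"
  shows "information_matrix g \<xi> \<theta> *v y = (\<Sum>x\<in>set_pmf \<xi>. pmf \<xi> x *\<^sub>R ((g \<theta> x \<bullet> y) *\<^sub>R g \<theta> x))"
  using assms
  by (simp add: information_matrix_sum sum_matrix_vector_mult outer_product_mult_vec
      flip: scaleR_matrix_vector_assoc)

lemma information_matrix_quadratic:
  assumes "finite (set_pmf \<xi>)"
  shows "y \<bullet> (information_matrix g \<xi> \<theta> *v y) = (\<Sum>x\<in>set_pmf \<xi>. pmf \<xi> x * (g \<theta> x \<bullet> y)\<^sup>2)"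
  using assms by (simp add: information_matrix_mult_vec inner_sum_right power2_eq_square inner_commute mult.assoc)

lemma information_matrix_quadratic_nonneg:
  assumes "finite (set_pmf \<xi>)"
  shows "0 \<le> y \<bullet> (information_matrix g \<xi> \<theta> *v y)"
  using assms by (simp add: information_matrix_quadratic sum_nonneg)

text \<open>The quadratic form is a sum of squares with positive weights. If it vanishes at
  \<open>y\<close>, every regressor on the support is orthogonal to \<open>y\<close>, so
  \<open>y\<close> lies in the kernel.\<close>

lemma information_matrix_pos_def:
  assumes "finite (set_pmf \<xi>)" "invertible (information_matrix g \<xi> \<theta>)" "y \<noteq> 0"
  shows "0 < y \<bullet> (information_matrix g \<xi> \<theta> *v y)"
proof (rule ccontr)
  let ?M = "information_matrix g \<xi> \<theta>"
  assume "\<not> 0 < y \<bullet> (?M *v y)"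
  then have "(\<Sum>x\<in>set_pmf \<xi>. pmf \<xi> x * (g \<theta> x \<bullet> y)\<^sup>2) = 0"
    using information_matrix_quadratic_nonneg[OF assms(1), of y g \<theta>] assms(1)
    by (simp add: information_matrix_quadratic)
  then have "\<forall>x\<in>set_pmf \<xi>. g \<theta> x \<bullet> y = 0"
    using assms(1) by (subst (asm) sum_nonneg_eq_0_iff) (auto simp: set_pmf_iff)
  then have "?M *v y = 0" using assms(1) by (simp add: information_matrix_mult_vec)
  then have "y = 0" by (metis matrix_inv_mult_vec_eqI[OF assms(2)] matrix_vector_mult_0_right)
  with assms(3) show False by simp
qed

text \<open>Diagonalizing together with \<open>mat 1\<close> expresses the determinant as a product
  of values of the quadratic form. This covers singular matrices as well.\<close>

lemma det_information_matrix_nonneg: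
  fixes g :: "'p \<Rightarrow> 'a \<Rightarrow> real ^ 'm"
  assumes "finite (set_pmf \<xi>)"
  shows "0 \<le> det (information_matrix g \<xi> \<theta>)"
proof -
  let ?M = "information_matrix g \<xi> \<theta>"
  obtain P :: "real ^ 'm ^ 'm" where "P ** mat 1 ** transpose P = mat 1"
    "\<And>i j. i \<noteq> j \<Longrightarrow> (P ** ?M ** transpose P) $ i $ j = 0"
    by (rule simultaneous_diagonalization[of "mat 1" ?M])
      (auto simp: transpose_mat transpose_information_matrix[OF assms])
  from det_eq_prod_diagonalized[OF this] show ?thesis
    using information_matrix_quadratic_nonneg[OF assms] by (auto intro!: prod_nonneg)
qed

section \<open>Local D-optimality as maximization of the determinant\<close>

lemma locally_D_optimal_alt:
  "locally_D_optimal X g \<theta> \<xi> \<longleftrightarrow> design_on X \<xi> \<and> invertible (information_matrix g \<xi> \<theta>) \<and>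
    (\<forall>\<eta>. design_on X \<eta> \<longrightarrow> det (information_matrix g \<eta> \<theta>) \<le> det (information_matrix g \<xi> \<theta>))"
  (is "?L \<longleftrightarrow> ?R")
proof -
  have *: "det (matrix_inv (information_matrix g \<xi> \<theta>)) \<le> det (matrix_inv (information_matrix g \<eta> \<theta>))
      \<longleftrightarrow> det (information_matrix g \<eta> \<theta>) \<le> det (information_matrix g \<xi> \<theta>)"
    if "design_on X \<xi>" "design_on X \<eta>" "invertible (information_matrix g \<xi> \<theta>)"
      "invertible (information_matrix g \<eta> \<theta>)" for \<eta>
    using that det_information_matrix_nonneg[of \<xi> g \<theta>] det_information_matrix_nonneg[of \<eta> g \<theta>]
    by (auto simp: det_matrix_inv invertible_det_nz design_on_def field_simps)
  have "det (information_matrix g \<eta> \<theta>) \<le> det (information_matrix g \<xi> \<theta>)"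
    if "design_on X \<xi>" "\<not> invertible (information_matrix g \<eta> \<theta>)" for \<eta>
    using that det_information_matrix_nonneg[of \<xi> g \<theta>] by (auto simp: invertible_det_nz design_on_def)
  with * show ?thesis unfolding locally_D_optimal_def by blast
qed

text \<open>The sufficient half of the Kiefer--Wolfowitz equivalence theorem.\<close>
lemma locally_D_optimalI:
  fixes g :: "'p \<Rightarrow> 'a \<Rightarrow> real ^ 'm"
  assumes design: "design_on X \<xi>" and inv: "invertible (information_matrix g \<xi> \<theta>)"
    and bound: "\<And>x. x \<in> X \<Longrightarrow>
      g \<theta> x \<bullet> (matrix_inv (information_matrix g \<xi> \<theta>) *v g \<theta> x) \<le> real CARD('m)"
  shows "locally_D_optimal X g \<theta> \<xi>"
  unfolding locally_D_optimal_alt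
proof (intro conjI allI impI design inv)
  fix \<eta> assume \<eta>: "design_on X \<eta>"
  let ?M = "information_matrix g \<xi> \<theta>" and ?N = "information_matrix g \<eta> \<theta>"
  have fin: "finite (set_pmf \<xi>)" "finite (set_pmf \<eta>)" and sub: "set_pmf \<eta> \<subseteq> X"
    using design \<eta> by (auto simp: design_on_def)
  obtain P :: "real ^ 'm ^ 'm" where P: "P ** ?M ** transpose P = mat 1"
    "\<And>i j. i \<noteq> j \<Longrightarrow> (P ** ?N ** transpose P) $ i $ j = 0"
    by (rule simultaneous_diagonalization[OF transpose_information_matrix[OF fin(1), of g \<theta>]
          transpose_information_matrix[OF fin(2), of g \<theta>]
          information_matrix_pos_def[OF fin(1) inv]])
      auto
  let ?d = "\<lambda>i. row i P \<bullet> (?N *v row i P)"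
  \<comment> \<open>The squared norm of \<open>P *v v\<close> is the sensitivity form, because
    \<open>transpose P ** P\<close> is the inverse of \<open>?M\<close>.\<close>
  have quad: "(\<Sum>i\<in>UNIV. (v \<bullet> row i P)\<^sup>2) = v \<bullet> (matrix_inv ?M *v v)" for v
  proof -
    have "(\<Sum>i\<in>UNIV. (v \<bullet> row i P)\<^sup>2) = (P *v v) \<bullet> (P *v v)"
      by (simp add: inner_vec_def[of "P *v v"] matrix_vector_mul_component row_def power2_eq_square
          inner_commute)
    also have "\<dots> = v \<bullet> ((transpose P ** P) *v v)"
      by (metis dot_lmul_matrix inner_commute matrix_vector_mul_assoc transpose_matrix_vector)
    finally show ?thesis by (simp add: transpose_mult_self_eq_matrix_inv[OF P(1)])
  qed
  \<comment> \<open>The sum of the diagonal entries is the trace of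
    \<open>matrix_inv ?M ** ?N\<close>, that is, the mean of the sensitivity function under
    \<open>\<eta>\<close>.\<close>
  have "sum ?d UNIV = (\<Sum>i\<in>UNIV. \<Sum>x\<in>set_pmf \<eta>. pmf \<eta> x * (g \<theta> x \<bullet> row i P)\<^sup>2)"
    using fin by (simp add: information_matrix_quadratic)
  also have "\<dots> = (\<Sum>x\<in>set_pmf \<eta>. pmf \<eta> x * (g \<theta> x \<bullet> (matrix_inv ?M *v g \<theta> x)))"
    by (subst sum.swap) (simp add: quad flip: sum_distrib_left)
  also have "\<dots> \<le> (\<Sum>x\<in>set_pmf \<eta>. pmf \<eta> x * real CARD('m))"
    using bound sub by (intro sum_mono mult_left_mono) auto
  also have "\<dots> = real CARD('m)"
    using fin by (simp add: sum_pmf_eq_1 flip: sum_distrib_right)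
  finally have "prod ?d UNIV \<le> 1"
    using information_matrix_quadratic_nonneg[OF fin(2)]
    by (intro prod_le_1_if_sum_le_card) auto
  then show "det ?N \<le> det ?M"
    using det_eq_prod_diagonalized[OF P] det_information_matrix_nonneg[OF fin(1), of g \<theta>]
    by (simp add: mult_left_le)
qed

section \<open>Mixtures with a one-point design and the intercept factorization\<close>

lemma information_matrix_linear_image:
  assumes "finite (set_pmf \<xi>)"
  shows "information_matrix (\<lambda>\<theta> x. T *v g \<theta> x) \<xi> \<theta> =
    T ** information_matrix g \<xi> \<theta> ** transpose T"
proof -
  have "information_matrix (\<lambda>\<theta> x. T *v g \<theta> x) \<xi> \<theta> *v y =
      (T ** information_matrix g \<xi> \<theta> ** transpose T) *v y" for y
  proof -
    have "(T *v a) \<bullet> y = a \<bullet> (transpose T *v y)" for a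
      by (metis dot_lmul_matrix inner_commute transpose_matrix_vector)
    then show ?thesis
      using assms by (simp add: information_matrix_mult_vec matrix_vector_mult_scaleR
          linear_sum[OF matrix_vector_mul_linear] flip: matrix_vector_mul_assoc)
  qed
  then show ?thesis by (simp add: matrix_eq)
qed

text \<open>The point \<open>z\<close> may also carry weight under \<open>\<eta>\<close>, so both
  sums are first extended by points of weight zero to a common finite set.\<close>

lemma mixture_sum:
  fixes \<phi> :: "'a \<Rightarrow> 'b::real_vector"
  assumes fin: "finite (set_pmf \<xi>)" "finite (set_pmf \<eta>)"
    and mixture: "\<And>x. pmf \<xi> x = p * pmf (return_pmf z) x + q * pmf \<eta> x"
  shows "(\<Sum>x\<in>set_pmf \<xi>. pmf \<xi> x *\<^sub>R \<phi> x) =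
    p *\<^sub>R \<phi> z + q *\<^sub>R (\<Sum>x\<in>set_pmf \<eta>. pmf \<eta> x *\<^sub>R \<phi> x)"
proof -
  let ?A = "insert z (set_pmf \<xi> \<union> set_pmf \<eta>)"
  have "(\<Sum>x\<in>set_pmf \<xi>. pmf \<xi> x *\<^sub>R \<phi> x) = (\<Sum>x\<in>?A. pmf \<xi> x *\<^sub>R \<phi> x)"
    using fin by (intro sum.mono_neutral_left) (auto simp: set_pmf_iff)
  also have "\<dots> = (\<Sum>x\<in>?A. if x = z then p *\<^sub>R \<phi> z else 0) + q *\<^sub>R (\<Sum>x\<in>?A. pmf \<eta> x *\<^sub>R \<phi> x)"
    unfolding scaleR_sum_right sum.distrib[symmetric]
    by (intro sum.cong) (auto simp: mixture scaleR_left_distrib)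
  also have "(\<Sum>x\<in>?A. if x = z then p *\<^sub>R \<phi> z else 0) = p *\<^sub>R \<phi> z"
    using fin by (subst sum.delta) auto
  also have "(\<Sum>x\<in>?A. pmf \<eta> x *\<^sub>R \<phi> x) = (\<Sum>x\<in>set_pmf \<eta>. pmf \<eta> x *\<^sub>R \<phi> x)"
    using fin by (intro sum.mono_neutral_right) (auto simp: set_pmf_iff)
  finally show ?thesis .
qed

lemma with_intercept_nth [simp]:
  "with_intercept a v $ None = a" "with_intercept a v $ Some j = v $ j"
  by (simp_all add: with_intercept_def)

lemma with_intercept_eq_iff: "y = with_intercept a v \<longleftrightarrow> y $ None = a \<and> (\<forall>j. y $ Some j = v $ j)"
  by (auto simp: vec_eq_iff split_option_all)

lemma sum_UNIV_option: "sum h (UNIV :: 'n::finite option set) = h None + (\<Sum>j\<in>UNIV. h (Some j))"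
  by (simp add: UNIV_option_conv sum.reindex)

lemma inner_with_intercept: "with_intercept a v \<bullet> with_intercept b w = a * b + v \<bullet> w"
  by (simp add: inner_vec_def sum_UNIV_option)

text \<open>The condition on \<open>c\<close> is the normal equation for the least squares fit of
  the constant 1 by \<open>g\<close> under \<open>\<eta>\<close>. Hence the residual
  \<open>1 - g \<theta> x \<bullet> c\<close> is orthogonal to every component of \<open>g\<close>,
  and the first factor is \<open>p\<close> plus \<open>q\<close> times the residual sum of
  squares.\<close>

lemma det_information_matrix_intercept:
  fixes g :: "'p \<Rightarrow> 'a \<Rightarrow> real ^ 'n" and F :: "'q \<Rightarrow> 'a \<Rightarrow> real ^ ('n option)"
  assumes fin: "finite (set_pmf \<xi>)" "finite (set_pmf \<eta>)"
    and mixture: "\<And>x. pmf \<xi> x = p * pmf (return_pmf z) x + q * pmf \<eta> x"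
    and F: "\<And>x. x \<in> set_pmf \<xi> \<Longrightarrow> F \<theta>' x = with_intercept 1 (g \<theta> x)"
    and zero: "g \<theta> z = 0"
    and c: "information_matrix g \<eta> \<theta> *v c = (\<Sum>x\<in>set_pmf \<eta>. pmf \<eta> x *\<^sub>R g \<theta> x)"
  shows "det (information_matrix F \<xi> \<theta>') =
    (p + q * (\<Sum>x\<in>set_pmf \<eta>. pmf \<eta> x * (1 - g \<theta> x \<bullet> c)\<^sup>2)) *
    (q ^ CARD('n) * det (information_matrix g \<eta> \<theta>))"
proof -
  define T :: "real ^ 'n option ^ 'n option" where
    "T = (\<chi> i. case i of None \<Rightarrow> with_intercept 1 (- c) | Some j \<Rightarrow> with_intercept 0 (axis j 1))"
  have T: "T *v with_intercept a v = with_intercept (a - v \<bullet> c) v" for a v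
    by (simp add: with_intercept_eq_iff T_def matrix_vector_mul_component inner_with_intercept
        inner_axis inner_axis' inner_commute)
  \<comment> \<open>The block rule needs zeros in row \<open>None\<close>. In \<open>T\<close> that
    row contains \<open>- c\<close>, whereas in the transpose it is a unit vector.\<close>
  have "det (transpose T) = 1 * det (mat 1 :: real ^ 'n ^ 'n)"
    by (subst det_block_option)
      (auto simp: T_def transpose_def axis_def mat_def intro!: arg_cong[where f = det])
  then have detT: "det T = 1" by simp
  let ?G = "\<lambda>\<theta> x. with_intercept (1 - g \<theta> x \<bullet> c) (g \<theta> x)"
  let ?M = "information_matrix ?G \<xi> \<theta>" and ?N = "information_matrix g \<eta> \<theta>"
  have "?M = information_matrix (\<lambda>\<theta> x. T *v F \<theta> x) \<xi> \<theta>'"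
    using F by (intro information_matrix_cong fin) (simp add: T)
  then have det_eq: "det ?M = det (information_matrix F \<xi> \<theta>')"
    by (simp add: information_matrix_linear_image[OF fin(1)] det_mul detT)
  have M: "?M $ i $ j = p * (?G \<theta> z $ i * ?G \<theta> z $ j) +
      q * (\<Sum>x\<in>set_pmf \<eta>. pmf \<eta> x * (?G \<theta> x $ i * ?G \<theta> x $ j))" for i j
    using mixture_sum[OF fin mixture, of "\<lambda>x. ?G \<theta> x $ i * ?G \<theta> x $ j"]
    by (simp add: information_matrix_sum[OF fin(1)] outer_product_def)
  have off: "?M $ None $ Some j = 0" for j
  proof -
    \<comment> \<open>The difference on the right is component \<open>j\<close> of the normal
      equation; the point \<open>z\<close> adds nothing since \<open>g\<close> vanishes
      there.\<close>
    have "(\<Sum>x\<in>set_pmf \<eta>. pmf \<eta> x * ((1 - g \<theta> x \<bullet> c) * g \<theta> x $ j)) =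
        (\<Sum>x\<in>set_pmf \<eta>. pmf \<eta> x *\<^sub>R g \<theta> x) $ j - (?N *v c) $ j"
      by (simp add: information_matrix_mult_vec[OF fin(2)] algebra_simps flip: sum_subtractf)
    then show ?thesis by (simp add: M zero c)
  qed
  have "det ?M = ?M $ None $ None * det (\<chi> i j. ?M $ Some i $ Some j)"
    by (rule det_block_option[OF off])
  also have "?M $ None $ None = p + q * (\<Sum>x\<in>set_pmf \<eta>. pmf \<eta> x * (1 - g \<theta> x \<bullet> c)\<^sup>2)"
    by (simp add: M zero power2_eq_square)
  also have "(\<chi> i j. ?M $ Some i $ Some j) = q *\<^sub>R ?N"
    by (simp add: vec_eq_iff M zero information_matrix_sum[OF fin(2)] outer_product_def)
  finally show ?thesis by (simp add: det_eq det_scaleR)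
qed

text \<open>A biased coin decides which of the two distributions is sampled. This supplies the
  competing designs in the model with intercept.\<close>

lemma mixture_pmf_exists:
  assumes "0 \<le> p" "p \<le> 1"
  obtains \<zeta> where "\<And>x. pmf \<zeta> x = p * pmf \<xi> x + (1 - p) * pmf \<eta> x"
    "set_pmf \<zeta> \<subseteq> set_pmf \<xi> \<union> set_pmf \<eta>"
proof
  let ?\<zeta> = "bernoulli_pmf p \<bind> (\<lambda>b. if b then \<xi> else \<eta>)"
  show "pmf ?\<zeta> x = p * pmf \<xi> x + (1 - p) * pmf \<eta> x" for x
    using assms by (simp add: pmf_bind)
  show "set_pmf ?\<zeta> \<subseteq> set_pmf \<xi> \<union> set_pmf \<eta>"
    by (auto split: if_splits)
qed

section \<open>Transfer of D-optimality between the two models\<close>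

theorem corollary5p1:
  fixes X Xt :: "(real ^ 'n) set"
    and h :: "real ^ 'n \<Rightarrow> real ^ ('n option) \<Rightarrow> real"
    and ht :: "real ^ 'n \<Rightarrow> real ^ 'n \<Rightarrow> real"
    and f :: "real ^ ('n option) \<Rightarrow> real ^ 'n \<Rightarrow> real ^ 'n"
    and ft :: "real ^ 'n \<Rightarrow> real ^ 'n \<Rightarrow> real ^ 'n"
    and \<beta> :: "real ^ ('n option)" and \<beta>0 :: real and \<beta>t c :: "real ^ 'n"
    and \<xi> \<xi>m :: "(real ^ 'n) pmf"
  assumes regions: "Xt \<subseteq> X"
    and param: "\<beta> = with_intercept \<beta>0 \<beta>t"
    and model_intercept: "\<And>x. x \<in> X \<Longrightarrow> GDERIV (h x) \<beta> :> with_intercept 1 (f \<beta> x)"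
    and model_no_intercept: "\<And>x. x \<in> Xt \<Longrightarrow> GDERIV (ht x) \<beta>t :> ft \<beta>t x"
    \<comment> \<open>At points of \<open>X\<close> outside the region \<open>Xt\<close> of the model without intercept, the expression
      \<open>ft \<beta>t x\<close> denotes the partial derivatives from the corresponding model with intercept.\<close>
    and ft_outside: "\<And>x. x \<in> X - Xt \<Longrightarrow> ft \<beta>t x = f \<beta> x"
    and design: "design_on X \<xi>" and origin: "0 \<in> set_pmf \<xi>"
    and cond_exists: "set_pmf \<xi> \<inter> {x. x \<noteq> 0} \<noteq> {}"
    and cond: "\<xi>m = cond_pmf \<xi> {x. x \<noteq> 0}"
    and design_m: "design_on Xt \<xi>m"
    and agree: "\<And>x. x \<in> Xt \<Longrightarrow> f \<beta> x = ft \<beta>t x"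
    and zero: "ft \<beta>t 0 = 0"
    and const: "\<And>x. x \<in> set_pmf \<xi> - {0} \<Longrightarrow> c \<bullet> ft \<beta>t x = 1"
    and mixture: "\<And>x. pmf \<xi> x = 1 / (real CARD('n) + 1) * pmf (return_pmf 0) x
                       + real CARD('n) / (real CARD('n) + 1) * pmf \<xi>m x"
  shows "(locally_D_optimal X (\<lambda>b x. with_intercept 1 (f b x)) \<beta> \<xi>
            \<longrightarrow> locally_D_optimal Xt ft \<beta>t \<xi>m) \<and>
         (locally_D_optimal Xt ft \<beta>t \<xi>m \<and>
          (\<forall>x\<in>X. ft \<beta>t x \<bullet> (matrix_inv (information_matrix ft \<xi>m \<beta>t) *v ft \<beta>t x)
                   \<le> real CARD('n) * (1 - (c \<bullet> ft \<beta>t x - 1)\<^sup>2))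
            \<longrightarrow> locally_D_optimal X (\<lambda>b x. with_intercept 1 (f b x)) \<beta> \<xi>)"
proof (intro conjI impI)
  let ?F = "\<lambda>b x. with_intercept 1 (f b x)" and ?g = "ft \<beta>t" and ?\<nu> = "real CARD('n)"
  let ?M = "\<lambda>\<eta>. information_matrix ?F \<eta> \<beta>" and ?Mt = "\<lambda>\<eta>. information_matrix ft \<eta> \<beta>t"
  define p where "p = 1 / (?\<nu> + 1)"
  define q where "q = ?\<nu> / (?\<nu> + 1)"
  have pq: "0 < p" "0 < q" "q = 1 - p" "p \<le> 1" by (auto simp: p_def q_def field_simps)
  note mix = mixture[folded p_def q_def]
  have F: "?F \<beta> x = with_intercept 1 (?g x)" if "x \<in> X" for x
    using that agree ft_outside by (cases "x \<in> Xt") auto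
  have fin: "finite (set_pmf \<xi>)" "finite (set_pmf \<xi>m)" and sub: "set_pmf \<xi> \<subseteq> X"
    using design design_m by (auto simp: design_on_def)
  have "set_pmf \<xi>m = set_pmf \<xi> - {0}"
    using set_cond_pmf[OF cond_exists] cond by auto
  then have c1: "?g x \<bullet> c = 1" if "x \<in> set_pmf \<xi>m" for x
    using const that by (simp add: inner_commute)
  \<comment> \<open>The given \<open>c\<close> solves the normal equation for \<open>\<xi>m\<close>
    with residual zero, so only \<open>p\<close> remains of the first factor in the determinant
    formula.\<close>
  have Mt_c: "?Mt \<xi>m *v c = (\<Sum>x\<in>set_pmf \<xi>m. pmf \<xi>m x *\<^sub>R ?g x)"
    by (simp add: information_matrix_mult_vec[OF fin(2)] c1)
  have det_\<xi>: "det (?M \<xi>) = p * (q ^ CARD('n) * det (?Mt \<xi>m))"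
    using det_information_matrix_intercept[OF fin mix, where F = ?F and \<theta>' = \<beta>, OF _ zero Mt_c]
      F sub by (auto simp: c1)
  {
    assume opt: "locally_D_optimal X ?F \<beta> \<xi>"
    have "det (?Mt \<eta>) \<le> det (?Mt \<xi>m)" if \<eta>: "design_on Xt \<eta>" for \<eta>
    proof (cases "invertible (?Mt \<eta>)")
      case False
      then show ?thesis
        using det_information_matrix_nonneg[OF fin(2), of ft \<beta>t] by (simp add: invertible_det_nz)
    next
      case True
      have fin_\<eta>: "finite (set_pmf \<eta>)" using \<eta> by (simp add: design_on_def)
      \<comment> \<open>The competitor \<open>\<eta>\<close> is mixed with the origin in the same
        proportions as in \<open>\<xi>\<close>, giving a competitor of \<open>\<xi>\<close> on
        \<open>X\<close>.\<close>
      obtain \<zeta> where \<zeta>: "\<And>x. pmf \<zeta> x = p * pmf (return_pmf 0) x + q * pmf \<eta> x"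
        and sub_\<zeta>: "set_pmf \<zeta> \<subseteq> set_pmf (return_pmf 0) \<union> set_pmf \<eta>"
        using mixture_pmf_exists[of p "return_pmf 0" \<eta>] pq by auto
      have fin_\<zeta>: "finite (set_pmf \<zeta>)"
        using finite_subset[OF sub_\<zeta>] fin_\<eta> by simp
      have \<zeta>_X: "set_pmf \<zeta> \<subseteq> X"
        using sub_\<zeta> \<eta> origin sub regions by (auto simp: design_on_def)
      define s where "s = (\<Sum>x\<in>set_pmf \<eta>. pmf \<eta> x *\<^sub>R ?g x)"
      \<comment> \<open>Under \<open>\<eta>\<close> the vector \<open>c\<close> may fail the normal
        equation, so the least squares solution for \<open>\<eta>\<close> takes its place.\<close>
      define c' where "c' = matrix_inv (?Mt \<eta>) *v s"
      have "?Mt \<eta> *v c' = s"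
        by (simp add: c'_def matrix_vector_mul_assoc matrix_inv_mult[OF True])
      then have "det (?M \<zeta>) = (p + q * (\<Sum>x\<in>set_pmf \<eta>. pmf \<eta> x * (1 - ?g x \<bullet> c')\<^sup>2)) *
          (q ^ CARD('n) * det (?Mt \<eta>))"
        unfolding s_def using F \<zeta>_X
        by (intro det_information_matrix_intercept[OF fin_\<zeta> fin_\<eta> \<zeta>]) (auto simp: zero)
      \<comment> \<open>Dropping the nonnegative residual sum leaves the factor that also occurs in
        \<open>det_\<xi>\<close>, so it cancels in the final comparison.\<close>
      also have "\<dots> \<ge> p * (q ^ CARD('n) * det (?Mt \<eta>))"
        using pq det_information_matrix_nonneg[OF fin_\<eta>, of ft \<beta>t]
        by (intro mult_right_mono) (auto intro!: mult_nonneg_nonneg sum_nonneg)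
      also have "det (?M \<zeta>) \<le> det (?M \<xi>)"
        using opt fin_\<zeta> \<zeta>_X by (simp add: locally_D_optimal_alt design_on_def)
      finally show ?thesis using pq by (simp add: det_\<xi>)
    qed
    then show "locally_D_optimal Xt ft \<beta>t \<xi>m"
      using opt design_m by (auto simp: locally_D_optimal_alt invertible_det_nz det_\<xi>)
  next
    assume opt: "locally_D_optimal Xt ft \<beta>t \<xi>m \<and>
      (\<forall>x\<in>X. ?g x \<bullet> (matrix_inv (?Mt \<xi>m) *v ?g x) \<le> ?\<nu> * (1 - (c \<bullet> ?g x - 1)\<^sup>2))"
    then have inv_t: "invertible (?Mt \<xi>m)" by (simp add: locally_D_optimal_alt)
    then have inv: "invertible (?M \<xi>)" using pq by (simp add: invertible_det_nz det_\<xi>)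
    show "locally_D_optimal X ?F \<beta> \<xi>"
    proof (rule locally_D_optimalI[OF design inv])
      fix x assume x: "x \<in> X"
      define t where "t = ?g x"
      define w where "w = matrix_inv (?Mt \<xi>m) *v t"
      \<comment> \<open>The intercept row of the system reads
        \<open>p * a + t \<bullet> c = 1\<close>: the origin contributes \<open>p * a\<close> and
        the other support points contribute \<open>t \<bullet> c\<close>.\<close>
      define a where "a = (1 - t \<bullet> c) / p"
      txt \<open>Solves \<open>?M \<xi> *v y = with_intercept 1 t\<close>, which avoids inverting the block matrix.\<close>
      define y where "y = with_intercept a ((1 / q) *\<^sub>R w - a *\<^sub>R c)"
      have Mt_w: "?Mt \<xi>m *v w = t"
        by (simp add: w_def matrix_vector_mul_assoc matrix_inv_mult[OF inv_t])
      let ?S = "\<Sum>u\<in>set_pmf \<xi>m. pmf \<xi>m u *\<^sub>R ((?g u \<bullet> w) *\<^sub>R with_intercept 1 (?g u))"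
      have "?M \<xi> *v y = (\<Sum>u\<in>set_pmf \<xi>. pmf \<xi> u *\<^sub>R
          ((with_intercept 1 (?g u) \<bullet> y) *\<^sub>R with_intercept 1 (?g u)))"
        using F sub by (auto simp: information_matrix_mult_vec[OF fin(1)] intro!: sum.cong)
      also have "\<dots> = (p * a) *\<^sub>R with_intercept 1 0 + q *\<^sub>R (\<Sum>u\<in>set_pmf \<xi>m. pmf \<xi>m u *\<^sub>R
          ((with_intercept 1 (?g u) \<bullet> y) *\<^sub>R with_intercept 1 (?g u)))"
        by (subst mixture_sum[OF fin mix]) (simp add: zero y_def inner_with_intercept)
      \<comment> \<open>On the support of \<open>\<xi>m\<close> the two terms with \<open>a\<close>
        cancel, because \<open>?g u \<bullet> c = 1\<close>, and the factor \<open>1 / q\<close>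
        absorbs the mixture weight.\<close>
      also have "q *\<^sub>R (\<Sum>u\<in>set_pmf \<xi>m. pmf \<xi>m u *\<^sub>R
          ((with_intercept 1 (?g u) \<bullet> y) *\<^sub>R with_intercept 1 (?g u))) = ?S"
        unfolding scaleR_sum_right using pq
        by (intro sum.cong) (auto simp: y_def inner_with_intercept inner_diff_right c1)
      also have "?S = with_intercept (t \<bullet> c) t"
      proof -
        have t_eq: "(\<Sum>u\<in>set_pmf \<xi>m. pmf \<xi>m u *\<^sub>R ((?g u \<bullet> w) *\<^sub>R ?g u)) = t"
          using Mt_w by (simp only: information_matrix_mult_vec[OF fin(2)])
        \<comment> \<open>Each intercept entry 1 equals \<open>?g u \<bullet> c\<close> on the
          support, which turns the sum into the inner product of \<open>t\<close> with
          \<open>c\<close>.\<close>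
        have "?S $ None = t \<bullet> c"
          unfolding t_eq[symmetric] by (simp add: inner_sum_left c1)
        moreover have "?S $ Some j = t $ j" for j
          unfolding t_eq[symmetric] by simp
        ultimately show ?thesis by (simp only: with_intercept_eq_iff) blast
      qed
      also have "(p * a) *\<^sub>R with_intercept 1 0 + with_intercept (t \<bullet> c) t = with_intercept 1 t"
        using pq by (simp add: with_intercept_eq_iff a_def)
      finally have "matrix_inv (?M \<xi>) *v with_intercept 1 t = y"
        by (rule matrix_inv_mult_vec_eqI[OF inv])
      then have "?F \<beta> x \<bullet> (matrix_inv (?M \<xi>) *v ?F \<beta> x) = a * (1 - t \<bullet> c) + (t \<bullet> w) / q"
        by (simp add: F[OF x] t_def[symmetric] y_def inner_with_intercept inner_diff_right algebra_simps)
      \<comment> \<open>Here \<open>1 / p = ?\<nu> + 1\<close> and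
        \<open>1 / q = (?\<nu> + 1) / ?\<nu>\<close>; the assumed inequality then says that the
        second factor is at most 1.\<close>
      also have "\<dots> = (?\<nu> + 1) * ((t \<bullet> c - 1)\<^sup>2 + (t \<bullet> w) / ?\<nu>)"
        by (simp add: a_def p_def q_def power2_eq_square field_simps)
      also have "\<dots> \<le> (?\<nu> + 1) * 1"
      proof (rule mult_left_mono)
        have "t \<bullet> w \<le> ?\<nu> * (1 - (t \<bullet> c - 1)\<^sup>2)"
          using opt x by (simp add: t_def w_def inner_commute)
        then show "(t \<bullet> c - 1)\<^sup>2 + (t \<bullet> w) / ?\<nu> \<le> 1" by (simp add: field_simps)
      qed simp
      finally show "?F \<beta> x \<bullet> (matrix_inv (?M \<xi>) *v ?F \<beta> x) \<le> real CARD('n option)"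
        by (simp add: card_UNIV_option)
    qed
  }
qed

end
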